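(* Let $\alpha,\beta\in\mathbb R$ and let $$S(\alpha,\beta)=\{X\in M_2 : X^2-\alpha X+\beta I_2=0 \text{ and } X\neq tI_2 \text{ for every } t\in\mathbb R\},$$ regarded as a subset of $\mathbb R^4$. 1. If $\alpha^2-4\beta>0$, then $S(\alpha,\beta)$ is a hyperboloid of one sheet. 2. If $\alpha^2-4\beta=0$, then $S(\alpha,\beta)$ is a right circular cone. 3. If $\alpha^2-4\beta<0$, then $S(\alpha,\beta)$ is a hyperboloid of two sheets.
   Context: $M_2$ is the set of real $2\times 2$ matrices and $I_2$ is the $2\times 2$ identity matrix. A matrix $X=\begin{bmatrix} x_1 & x_2 \\ x_3 & x_4 \end{bmatrix}\in M_2$ is identified with the point $(x_1,x_2,x_3,x_4)$ of Euclidean space $\mathbb R^4$. The set $S(\alpha,\beta)$ lies in the hyperplane $x_1+x_4=\alpha$ of $\mathbb R^4$, which is a three-dimensional Euclidean space; the terms hyperboloid of one sheet, hyperboloid of two sheets and right circular cone refer to the usual quadric surfaces in this three-dimensional space.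
   Formalization: In case 2, S(α,β) is shown to be a right circular cone with its apex removed, not the full cone: the apex (α/2)I₂ is a scalar matrix, so it is excluded from S(α,β) by definition. *)

theory Defs
  imports "HOL-Analysis.Analysis"
begin

text \<open>Matrix squares are written with \<open>**\<close>, since multiplication and powers on
  \<open>real^2^2\<close> act entrywise.\<close>

definition S :: "real \<Rightarrow> real \<Rightarrow> (real^2^2) set" where
  "S \<alpha> \<beta> = {X. X ** X - \<alpha> *\<^sub>R X + \<beta> *\<^sub>R mat 1 = 0 \<and> (\<forall>t. X \<noteq> t *\<^sub>R mat 1)}"

definition point_of_matrix :: "real^2^2 \<Rightarrow> real^4" where
  "point_of_matrix X = vector [X$1$1, X$1$2, X$2$1, X$2$2]"

definition trace_hyperplane :: "real \<Rightarrow> (real^4) set" where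
  "trace_hyperplane \<alpha> = {x. x$1 + x$4 = \<alpha>}"

text \<open>A Cartesian coordinate system, with origin \<open>p\<close> and orthonormal axes \<open>u\<close>, \<open>v\<close>, \<open>w\<close>,
  of \<open>H\<close>; the last conjunct forces \<open>H\<close> to be a three-dimensional affine subspace.\<close>

definition cartesian_frame ::
  "'a::euclidean_space set \<Rightarrow> 'a \<Rightarrow> 'a \<Rightarrow> 'a \<Rightarrow> 'a \<Rightarrow> bool" where
  "cartesian_frame H p u v w \<longleftrightarrow>
     norm u = 1 \<and> norm v = 1 \<and> norm w = 1 \<and>
     u \<bullet> v = 0 \<and> u \<bullet> w = 0 \<and> v \<bullet> w = 0 \<and>
     H = {p + x *\<^sub>R u + y *\<^sub>R v + z *\<^sub>R w | x y z. True}"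

definition hyperboloid_of_one_sheet ::
  "'a::euclidean_space set \<Rightarrow> 'a set \<Rightarrow> bool" where
  "hyperboloid_of_one_sheet H Q \<longleftrightarrow>
     (\<exists>p u v w a b c. cartesian_frame H p u v w \<and> a > 0 \<and> b > 0 \<and> c > 0 \<and>
        Q = {p + x *\<^sub>R u + y *\<^sub>R v + z *\<^sub>R w | x y z.
               x\<^sup>2 / a\<^sup>2 + y\<^sup>2 / b\<^sup>2 - z\<^sup>2 / c\<^sup>2 = 1})"

definition hyperboloid_of_two_sheets ::
  "'a::euclidean_space set \<Rightarrow> 'a set \<Rightarrow> bool" where
  "hyperboloid_of_two_sheets H Q \<longleftrightarrow>
     (\<exists>p u v w a b c. cartesian_frame H p u v w \<and> a > 0 \<and> b > 0 \<and> c > 0 \<and>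
        Q = {p + x *\<^sub>R u + y *\<^sub>R v + z *\<^sub>R w | x y z.
               x\<^sup>2 / a\<^sup>2 + y\<^sup>2 / b\<^sup>2 - z\<^sup>2 / c\<^sup>2 = -1})"

text \<open>The complete double cone with apex \<open>p\<close>, which belongs to the cone. Equal semi-axes in the
  directions orthogonal to the axis \<open>w\<close> make it right circular.\<close>

definition right_circular_cone ::
  "'a::euclidean_space set \<Rightarrow> 'a \<Rightarrow> 'a set \<Rightarrow> bool" where
  "right_circular_cone H p Q \<longleftrightarrow>
     (\<exists>u v w a c. cartesian_frame H p u v w \<and> a > 0 \<and> c > 0 \<and>
        Q = {p + x *\<^sub>R u + y *\<^sub>R v + z *\<^sub>R w | x y z.
               x\<^sup>2 / a\<^sup>2 + y\<^sup>2 / a\<^sup>2 - z\<^sup>2 / c\<^sup>2 = 0})"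

end

theory Submission
  imports Defs
begin

text \<open>A matrix \<open>X\<close> that is not a multiple of the identity has minimal polynomial of degree two, so
  by the Cayley-Hamilton theorem \<open>X\<close> satisfies \<open>X\<^sup>2 - \<alpha> X + \<beta> I = 0\<close> exactly when \<open>\<alpha>\<close> is its trace
  and \<open>\<beta>\<close> its determinant (\<open>mem_S_iff\<close>). The trace condition says that \<open>X\<close> lies in the hyperplane.
  There, the determinant condition is a quadratic equation, and the splitting of \<open>X - (\<alpha>/2) I\<close> into
  a diagonal, a symmetric off-diagonal and a skew part diagonalises it: in the corresponding
  orthonormal coordinates, centred at \<open>(\<alpha>/2) I\<close>, it becomes \<open>x\<^sup>2 + y\<^sup>2 - z\<^sup>2 = (\<alpha>\<^sup>2 - 4 \<beta>) / 2\<close>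
  (\<open>image_S_eq\<close>). The sign of the right-hand side decides the type of the quadric. The only scalar
  matrix of trace \<open>\<alpha>\<close> is the centre, which satisfies the equation only when the right-hand side
  vanishes, and then it is the apex of the cone.\<close>

lemma vector_4_nth [simp]:
  "(vector [a, b, c, d] :: 'a::zero^4) $ 1 = a"
  "(vector [a, b, c, d] :: 'a::zero^4) $ 2 = b"
  "(vector [a, b, c, d] :: 'a::zero^4) $ 3 = c"
  "(vector [a, b, c, d] :: 'a::zero^4) $ 4 = d"
  by (simp_all add: vector_def)

lemma point_of_matrix_nth [simp]:
  "point_of_matrix X $ 1 = X$1$1" "point_of_matrix X $ 2 = X$1$2"
  "point_of_matrix X $ 3 = X$2$1" "point_of_matrix X $ 4 = X$2$2"
  by (simp_all add: point_of_matrix_def)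

text \<open>Off the diagonal, the matrix equation reads \<open>X\<^sub>1\<^sub>2 (tr X - \<alpha>) = 0\<close> and
  \<open>X\<^sub>2\<^sub>1 (tr X - \<alpha>) = 0\<close>, and its two diagonal entries differ by \<open>(X\<^sub>1\<^sub>1 - X\<^sub>2\<^sub>2) (tr X - \<alpha>)\<close>.
  For a non-scalar matrix one of \<open>X\<^sub>1\<^sub>2\<close>, \<open>X\<^sub>2\<^sub>1\<close>, \<open>X\<^sub>1\<^sub>1 - X\<^sub>2\<^sub>2\<close> is nonzero, which forces the trace;
  the diagonal entries then give the determinant. The converse is the Cayley-Hamilton theorem.\<close>

lemma mem_S_iff:
  "X \<in> S \<alpha> \<beta> \<longleftrightarrow> trace X = \<alpha> \<and> det X = \<beta> \<and> X \<noteq> (\<alpha>/2) *\<^sub>R mat 1"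
proof -
  define a b c d where abcd: "a = X$1$1" "b = X$1$2" "c = X$2$1" "d = X$2$2"
  have eqn: "X ** X - \<alpha> *\<^sub>R X + \<beta> *\<^sub>R mat 1 = 0 \<longleftrightarrow>
      a*a + b*c - \<alpha>*a + \<beta> = 0 \<and> b*(a + d - \<alpha>) = 0 \<and>
      c*(a + d - \<alpha>) = 0 \<and> d*d + b*c - \<alpha>*d + \<beta> = 0"
    by (auto simp: vec_eq_iff forall_2 matrix_matrix_mult_def sum_2 mat_def abcd algebra_simps)
  have scalar: "X = t *\<^sub>R mat 1 \<longleftrightarrow> a = t \<and> b = 0 \<and> c = 0 \<and> d = t" for t
    by (auto simp: vec_eq_iff forall_2 mat_def abcd)
  have tr: "trace X = a + d" and det: "det X = a*d - b*c"
    by (simp_all add: trace_def sum_2 det_2 abcd)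
  show ?thesis
  proof
    assume "X \<in> S \<alpha> \<beta>"
    then have e: "a*a + b*c - \<alpha>*a + \<beta> = 0" "b*(a + d - \<alpha>) = 0"
        "c*(a + d - \<alpha>) = 0" "d*d + b*c - \<alpha>*d + \<beta> = 0"
      and ns: "\<And>t. X \<noteq> t *\<^sub>R mat 1"
      by (auto simp: S_def eqn)
    have "(a - d)*(a + d - \<alpha>) = 0"
      using e(1,4) by (simp add: algebra_simps)
    moreover have "a \<noteq> d \<or> b \<noteq> 0 \<or> c \<noteq> 0"
      using ns[of a] by (auto simp: scalar)
    ultimately have t: "\<alpha> = a + d"
      using e(2,3) by auto
    have "det X = \<beta>"
      using e(1) unfolding det t by (simp add: algebra_simps)
    with t ns show "trace X = \<alpha> \<and> det X = \<beta> \<and> X \<noteq> (\<alpha>/2) *\<^sub>R mat 1"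
      by (simp add: tr)
  next
    assume R: "trace X = \<alpha> \<and> det X = \<beta> \<and> X \<noteq> (\<alpha>/2) *\<^sub>R mat 1"
    then have t: "\<alpha> = a + d" and d: "\<beta> = a*d - b*c"
      by (simp_all add: tr det)
    have "X \<noteq> s *\<^sub>R mat 1" for s
      using R by (auto simp: scalar t)
    then show "X \<in> S \<alpha> \<beta>"
      unfolding S_def mem_Collect_eq eqn by (simp add: t d algebra_simps)
  qed
qed

definition centre :: "real \<Rightarrow> real^4" where
  "centre \<alpha> = vector [\<alpha>/2, 0, 0, \<alpha>/2]"

definition diag_axis :: "real^4" where
  "diag_axis = vector [1/sqrt 2, 0, 0, -1/sqrt 2]"

definition sym_axis :: "real^4" where
  "sym_axis = vector [0, 1/sqrt 2, 1/sqrt 2, 0]"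

definition skew_axis :: "real^4" where
  "skew_axis = vector [0, 1/sqrt 2, -1/sqrt 2, 0]"

abbreviation frame_point :: "real \<Rightarrow> real \<Rightarrow> real \<Rightarrow> real \<Rightarrow> real^4" where
  "frame_point \<alpha> x y z \<equiv>
     centre \<alpha> + x *\<^sub>R diag_axis + y *\<^sub>R sym_axis + z *\<^sub>R skew_axis"

lemma frame_point_nth:
  "frame_point \<alpha> x y z $ 1 = \<alpha>/2 + x / sqrt 2"
  "frame_point \<alpha> x y z $ 2 = (y + z) / sqrt 2"
  "frame_point \<alpha> x y z $ 3 = (y - z) / sqrt 2"
  "frame_point \<alpha> x y z $ 4 = \<alpha>/2 - x / sqrt 2"
  by (simp_all add: centre_def diag_axis_def sym_axis_def skew_axis_def field_simps)

lemma frame_point_coordinates: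
  assumes "q \<in> trace_hyperplane \<alpha>"
  shows "q = frame_point \<alpha> ((q$1 - q$4) / sqrt 2) ((q$2 + q$3) / sqrt 2) ((q$2 - q$3) / sqrt 2)"
  using assms unfolding vec_eq_iff forall_4 frame_point_nth
  by (auto simp: trace_hyperplane_def field_simps)

lemma cartesian_frame_trace_hyperplane:
  "cartesian_frame (trace_hyperplane \<alpha>) (centre \<alpha>) diag_axis sym_axis skew_axis"
proof -
  have "frame_point \<alpha> x y z \<in> trace_hyperplane \<alpha>" for x y z
    unfolding trace_hyperplane_def mem_Collect_eq frame_point_nth by simp
  then have "trace_hyperplane \<alpha> = {frame_point \<alpha> x y z | x y z. True}"
    using frame_point_coordinates by blast
  then show ?thesis
    unfolding cartesian_frame_def
    by (simp add: norm_eq_1 inner_vec_def sum_4 diag_axis_def sym_axis_def skew_axis_def)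
qed

text \<open>Since \<open>x\<^sub>1 x\<^sub>4 = \<alpha>\<^sup>2/4 - x\<^sup>2/2\<close> and \<open>x\<^sub>2 x\<^sub>3 = (y\<^sup>2 - z\<^sup>2)/2\<close>, the axes diagonalise the
  determinant. The centre is removed because it is the scalar matrix of trace \<open>\<alpha>\<close>.\<close>

lemma image_S_eq:
  "point_of_matrix ` S \<alpha> \<beta> =
     {frame_point \<alpha> x y z | x y z. x\<^sup>2 + y\<^sup>2 - z\<^sup>2 = (\<alpha>\<^sup>2 - 4 * \<beta>) / 2} - {centre \<alpha>}"
proof -
  have quadric: "q$1 * q$4 - q$2 * q$3 = \<beta> \<longleftrightarrow> x\<^sup>2 + y\<^sup>2 - z\<^sup>2 = (\<alpha>\<^sup>2 - 4 * \<beta>) / 2"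
    if "q = frame_point \<alpha> x y z" for q x y z
  proof -
    have "q$1 * q$4 - q$2 * q$3 = \<alpha>\<^sup>2 / 4 - (x\<^sup>2 + y\<^sup>2 - z\<^sup>2) / 2"
      unfolding that frame_point_nth by (simp add: field_simps power2_eq_square)
    then show ?thesis by (auto simp: field_simps)
  qed
  have coords: "q \<in> trace_hyperplane \<alpha> \<longleftrightarrow> (\<exists>x y z. q = frame_point \<alpha> x y z)" for q
    using cartesian_frame_trace_hyperplane unfolding cartesian_frame_def by blast
  have X_iff: "X \<in> S \<alpha> \<beta> \<longleftrightarrow> point_of_matrix X \<in> trace_hyperplane \<alpha> \<and>
      X$1$1 * X$2$2 - X$1$2 * X$2$1 = \<beta> \<and> point_of_matrix X \<noteq> centre \<alpha>" for X
    unfolding mem_S_iff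
    by (auto simp: trace_def sum_2 det_2 trace_hyperplane_def vec_eq_iff forall_2 forall_4
        mat_def centre_def)
  have surj: "\<exists>X. q = point_of_matrix X" for q
    by (rule exI[of _ "vector [vector [q$1, q$2], vector [q$3, q$4]]"])
      (simp add: vec_eq_iff forall_4)
  have image: "q \<in> point_of_matrix ` S \<alpha> \<beta> \<longleftrightarrow>
      q \<in> trace_hyperplane \<alpha> \<and> q$1 * q$4 - q$2 * q$3 = \<beta> \<and> q \<noteq> centre \<alpha>" for q
  proof -
    obtain X where q: "q = point_of_matrix X" using surj by blast
    show ?thesis
    proof
      assume "q \<in> point_of_matrix ` S \<alpha> \<beta>"
      then obtain Y where "q = point_of_matrix Y" "Y \<in> S \<alpha> \<beta>" by blast
      then show "q \<in> trace_hyperplane \<alpha> \<and> q$1 * q$4 - q$2 * q$3 = \<beta> \<and> q \<noteq> centre \<alpha>"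
        using X_iff by simp
    next
      assume "q \<in> trace_hyperplane \<alpha> \<and> q$1 * q$4 - q$2 * q$3 = \<beta> \<and> q \<noteq> centre \<alpha>"
      then have "X \<in> S \<alpha> \<beta>" using X_iff q by simp
      then show "q \<in> point_of_matrix ` S \<alpha> \<beta>" using q by blast
    qed
  qed
  show ?thesis
    unfolding set_eq_iff image coords Diff_iff mem_Collect_eq singleton_iff
    using quadric by blast
qed

lemma centre_not_on_quadric:
  assumes "k \<noteq> 0"
  shows "centre \<alpha> \<notin> {frame_point \<alpha> x y z | x y z. x\<^sup>2 + y\<^sup>2 - z\<^sup>2 = k}"
proof clarify
  fix x y z assume "centre \<alpha> = frame_point \<alpha> x y z" and k: "k = x\<^sup>2 + y\<^sup>2 - z\<^sup>2"
  then have "\<forall>i. centre \<alpha> $ i = frame_point \<alpha> x y z $ i"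
    by metis
  then have "x = 0 \<and> y + z = 0 \<and> y - z = 0"
    unfolding forall_4 frame_point_nth by (simp add: centre_def)
  then show False
    using assms k by simp
qed

theorem lemma2:
  fixes \<alpha> \<beta> :: real
  shows "(\<alpha>\<^sup>2 - 4 * \<beta> > 0 \<longrightarrow>
            hyperboloid_of_one_sheet (trace_hyperplane \<alpha>) (point_of_matrix ` S \<alpha> \<beta>)) \<and>
         (\<alpha>\<^sup>2 - 4 * \<beta> = 0 \<longrightarrow>
            (\<exists>apex C. right_circular_cone (trace_hyperplane \<alpha>) apex C \<and>
                      point_of_matrix ` S \<alpha> \<beta> = C - {apex})) \<and>
         (\<alpha>\<^sup>2 - 4 * \<beta> < 0 \<longrightarrow>
            hyperboloid_of_two_sheets (trace_hyperplane \<alpha>) (point_of_matrix ` S \<alpha> \<beta>))"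
proof (intro conjI impI)
  let ?k = "(\<alpha>\<^sup>2 - 4 * \<beta>) / 2"
  note frame = cartesian_frame_trace_hyperplane[of \<alpha>]
  have quadric: "point_of_matrix ` S \<alpha> \<beta> = {frame_point \<alpha> x y z | x y z. x\<^sup>2 + y\<^sup>2 - z\<^sup>2 = ?k}"
    if "?k \<noteq> 0"
    using image_S_eq centre_not_on_quadric[OF that] by simp
  {
    assume "\<alpha>\<^sup>2 - 4 * \<beta> > 0"
    then have k: "?k > 0" by simp
    define r where "r = sqrt ?k"
    have r: "r > 0" "r\<^sup>2 = ?k" using k by (simp_all add: r_def)
    have "x\<^sup>2 / r\<^sup>2 + y\<^sup>2 / r\<^sup>2 - z\<^sup>2 / r\<^sup>2 = 1 \<longleftrightarrow> x\<^sup>2 + y\<^sup>2 - z\<^sup>2 = ?k" for x y z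
      unfolding r(2) add_divide_distrib[symmetric] diff_divide_distrib[symmetric]
      using k by (simp add: divide_eq_eq)
    then have "point_of_matrix ` S \<alpha> \<beta> =
        {frame_point \<alpha> x y z | x y z. x\<^sup>2 / r\<^sup>2 + y\<^sup>2 / r\<^sup>2 - z\<^sup>2 / r\<^sup>2 = 1}"
      using quadric k by simp
    then show "hyperboloid_of_one_sheet (trace_hyperplane \<alpha>) (point_of_matrix ` S \<alpha> \<beta>)"
      unfolding hyperboloid_of_one_sheet_def using frame r(1) by blast
  next
    assume "\<alpha>\<^sup>2 - 4 * \<beta> = 0"
    then have "{frame_point \<alpha> x y z | x y z. x\<^sup>2 + y\<^sup>2 - z\<^sup>2 = ?k} =
        {frame_point \<alpha> x y z | x y z. x\<^sup>2 / 1\<^sup>2 + y\<^sup>2 / 1\<^sup>2 - z\<^sup>2 / 1\<^sup>2 = 0}"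
      by simp
    then have "right_circular_cone (trace_hyperplane \<alpha>) (centre \<alpha>)
        {frame_point \<alpha> x y z | x y z. x\<^sup>2 + y\<^sup>2 - z\<^sup>2 = ?k}"
      unfolding right_circular_cone_def using frame zero_less_one by blast
    then show "\<exists>apex C. right_circular_cone (trace_hyperplane \<alpha>) apex C \<and>
        point_of_matrix ` S \<alpha> \<beta> = C - {apex}"
      using image_S_eq by blast
  next
    assume "\<alpha>\<^sup>2 - 4 * \<beta> < 0"
    then have k: "?k < 0" by simp
    define r where "r = sqrt (- ?k)"
    have r: "r > 0" "r\<^sup>2 = - ?k" using k by (simp_all add: r_def)
    have "x\<^sup>2 / r\<^sup>2 + y\<^sup>2 / r\<^sup>2 - z\<^sup>2 / r\<^sup>2 = -1 \<longleftrightarrow> x\<^sup>2 + y\<^sup>2 - z\<^sup>2 = ?k" for x y z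
      unfolding r(2) add_divide_distrib[symmetric] diff_divide_distrib[symmetric]
      using k by (simp add: divide_eq_eq)
    then have "point_of_matrix ` S \<alpha> \<beta> =
        {frame_point \<alpha> x y z | x y z. x\<^sup>2 / r\<^sup>2 + y\<^sup>2 / r\<^sup>2 - z\<^sup>2 / r\<^sup>2 = -1}"
      using quadric k by simp
    then show "hyperboloid_of_two_sheets (trace_hyperplane \<alpha>) (point_of_matrix ` S \<alpha> \<beta>)"
      unfolding hyperboloid_of_two_sheets_def using frame r(1) by blast
  }
qed

end
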